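(* For any real Banach space $X$ (of dimension at least $2$) the following inequality is true: $$\frac{1}{1-\lambda_X^-\left(\frac{1-\lambda_X^-(1)}{2}\right)} \le \xi_X \le \frac{1}{1-\lambda_X^+\left(\frac{1-\lambda_X^-(1)}{2}\right)}.$$
   Context: Let $X$ be a real Banach space with $\dim X \ge 2$. Write $S_X=\{x\in X:\|x\|=1\}$, and for $x\in X$ let $J_1(x)=\{p\in X^*:\ \|p\|=1,\ p(x)=\|x\|\}$. For $x\in X\setminus\{0\}$ and $y\in X$, $y$ is quasiorthogonal to $x$, written $y\urcorner x$, if there is $p\in J_1(x)$ with $p(y)=0$. For $x,y\in S_X$ with $y\urcorner x$ and $r\in[0,1]$ put $\lambda_X(x,y,r)=\min\{\lambda\in\mathbb{R}:\ \|x+ry-\lambda x\|=1\}$. The modulus of supporting convexity and the modulus of supporting smoothness are, for $r\in[0,1]$, $$\lambda_X^-(r)=\inf\{\lambda_X(x,y,r):\ x,y\in S_X,\ y\urcorner x\},$$ $$\lambda_X^+(r)=\sup\{\lambda_X(x,y,t):\ x,y\in S_X,\ y\urcorner x,\ 0\le t\le r\}.$$ Finally, $$\xi_X=\sup_{\|x\|=1,\ \|y\|=1}\ \sup_{p\in J_1(y)}\|x-p(x)\,y\|.$$ *)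

theory Defs
  imports "HOL-Analysis.Analysis"
begin

definition J1 :: "'a::real_normed_vector \<Rightarrow> ('a \<Rightarrow>\<^sub>L real) set" where
  "J1 x = {p. norm p = 1 \<and> blinfun_apply p x = norm x}"

definition quasiorthogonal :: "'a::real_normed_vector \<Rightarrow> 'a \<Rightarrow> bool" where
  "quasiorthogonal y x \<longleftrightarrow> x \<noteq> 0 \<and> (\<exists>p\<in>J1 x. blinfun_apply p y = 0)"

(* Intended for unit x, y with quasiorthogonal y x and 0 \<le> r \<le> 1. There the minimum is
   attained and lies in {0..r}: the norm in question is at least 1 at l = 0, at most 1 at l = r,
   and greater than 1 for l < 0. *)
definition supp_lambda :: "'a::real_normed_vector \<Rightarrow> 'a \<Rightarrow> real \<Rightarrow> real" where
  "supp_lambda x y r = (LEAST l::real. norm (x + r *\<^sub>R y - l *\<^sub>R x) = 1)"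

definition supp_convexity_modulus :: "'a::real_normed_vector itself \<Rightarrow> real \<Rightarrow> real" where
  "supp_convexity_modulus _ r =
     Inf {supp_lambda x y r | x y :: 'a. norm x = 1 \<and> norm y = 1 \<and> quasiorthogonal y x}"

definition supp_smoothness_modulus :: "'a::real_normed_vector itself \<Rightarrow> real \<Rightarrow> real" where
  "supp_smoothness_modulus _ r =
     Sup {supp_lambda x y t | (x::'a) y t.
            norm x = 1 \<and> norm y = 1 \<and> quasiorthogonal y x \<and> 0 \<le> t \<and> t \<le> r}"

definition xi :: "'a::real_normed_vector itself \<Rightarrow> real" where
  "xi _ = (SUP (x, y) \<in> {(x::'a, y::'a). norm x = 1 \<and> norm y = 1}.
             SUP p \<in> J1 y. norm (x - blinfun_apply p x *\<^sub>R y))"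

end

theory Submission
  imports Defs
begin

text \<open>Write \<open>r = (1 - \<lambda>\<^sup>-(1)) / 2\<close>. Then \<open>2 * r\<close> is the supremum of the lengths of the chords
of the unit ball that start at a unit vector \<open>e\<close> and run parallel to a unit vector \<open>y\<close> to which
\<open>e\<close> is quasiorthogonal: the segment from \<open>e\<close> to \<open>e + \<mu> *\<^sub>R y\<close> with
\<open>\<mu> = 1 - \<lambda>(y, e, 1)\<close>.

Such a pair is also what \<open>\<xi>\<close> measures. Projecting the unit ball along \<open>y\<close> onto the kernel of a
functional that supports the ball at \<open>y\<close> and annihilates \<open>e\<close>, the extent of the image in the
direction \<open>e\<close> is \<open>1 / d\<close>, where \<open>d\<close> is the distance of \<open>e\<close> from the line \<open>\<real> y\<close>. So
\<open>\<xi>\<close> is the supremum of these \<open>1 / d\<close>.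

Let \<open>d *\<^sub>R x = e + b *\<^sub>R y\<close> be a point of \<open>e + \<real> y\<close> of least norm, with \<open>norm x = 1\<close>. Then \<open>y\<close> is
quasiorthogonal to \<open>x\<close>, because \<open>x\<close> is Birkhoff--James orthogonal to \<open>y\<close>
(\<open>nearest_point_on_line\<close>). Going down from the supporting line \<open>x + \<real> y\<close> in the direction
\<open>- x\<close> by \<open>1 - d\<close> leads to the line that carries the chord from \<open>e\<close>. Hence
\<open>\<lambda>(x, y, t) \<le> 1 - d\<close> as soon as \<open>d *\<^sub>R x + t *\<^sub>R y\<close> is in the ball, and
\<open>\<lambda>(x, y, t) \<ge> 1 - d\<close> as soon as it is not in the open ball (for \<open>0 \<le> t < 1\<close>). Both estimates
compare a chord with the points at the parameters \<open>\<plusminus> t\<close> on this line.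

\<^item> Lower bound: a chord of length \<open>\<mu>\<close> and the point \<open>d *\<^sub>R x\<close> are in the ball, so by convexity one
  of \<open>d *\<^sub>R x \<plusminus> (\<mu> / 2) *\<^sub>R y\<close> is as well. This gives \<open>\<lambda>\<^sup>-(\<mu> / 2) \<le> 1 - d\<close> with
  \<open>1 / d \<le> \<xi>\<close>. As \<open>\<mu>\<close> need not attain its supremum \<open>2 * r\<close>, a slope estimate for
  \<open>\<lambda>(x, y, \<cdot>)\<close> on \<open>[0, 1/2]\<close> moves \<open>\<mu> / 2\<close> to \<open>r\<close> (\<open>chord_length_bounds_xi\<close>).
\<^item> Upper bound: if both \<open>d *\<^sub>R x \<plusminus> r *\<^sub>R y\<close> were in the open ball, then \<open>e\<close>, which is on the same
  line but on the sphere, would be outside the segment that they span, and the chord from \<open>e\<close>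
  through that segment would be longer than \<open>2 * r\<close>. So \<open>1 - d \<le> \<lambda>\<^sup>+(r)\<close> for every pair
  (\<open>norm_projection_le_supp_smoothness\<close>).

Passing from Birkhoff--James orthogonality to a supporting functional on the whole space needs the
Hahn--Banach theorem. It is proved here from the fact that minimal sublinear functionals are
linear.\<close>

section \<open>Supporting functionals and Birkhoff--James orthogonality\<close>

text \<open>Only one inequality of positive homogeneity is required, as this is what survives the
passage to infima; the other one follows from it (\<open>sublinear_scaleR\<close>).\<close>

definition sublinear :: "('a::real_vector \<Rightarrow> real) \<Rightarrow> bool" where
  "sublinear N \<longleftrightarrow> (\<forall>v w. N (v + w) \<le> N v + N w) \<and> (\<forall>t v. 0 < t \<longrightarrow> N (t *\<^sub>R v) \<le> t * N v)"

lemma sublinear_add: "sublinear N \<Longrightarrow> N (v + w) \<le> N v + N w"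
  by (simp add: sublinear_def)

lemma sublinear_scaleR_le: "sublinear N \<Longrightarrow> 0 < t \<Longrightarrow> N (t *\<^sub>R v) \<le> t * N v"
  by (simp add: sublinear_def)

lemma sublinear_zero:
  assumes "sublinear N"
  shows "N 0 = 0"
  using sublinear_add[OF assms, of 0 0] sublinear_scaleR_le[OF assms, of "1/2" 0] by simp

lemma sublinear_scaleR:
  assumes "sublinear N" "0 \<le> t"
  shows "N (t *\<^sub>R v) = t * N v"
proof (cases "t = 0")
  case True
  then show ?thesis
    using sublinear_zero[OF assms(1)] by simp
next
  case False
  with assms have t: "0 < t" by simp
  have "N ((1/t) *\<^sub>R (t *\<^sub>R v)) \<le> 1/t * N (t *\<^sub>R v)"
    using t by (intro sublinear_scaleR_le[OF assms(1)]) simp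
  then have "t * N v \<le> N (t *\<^sub>R v)"
    using t by (simp add: field_simps)
  then show ?thesis
    using sublinear_scaleR_le[OF assms(1) t, of v] by simp
qed

lemma sublinear_neg_le:
  assumes "sublinear N"
  shows "- N (- v) \<le> N v"
  using sublinear_add[OF assms, of v "- v"] sublinear_zero[OF assms] by simp

lemma sublinear_norm: "sublinear (norm :: 'a::real_normed_vector \<Rightarrow> real)"
  by (simp add: sublinear_def norm_triangle_ineq)

text \<open>The bounds \<open>\<alpha>\<close> prescribed at points \<open>c\<close> are encoded as a cone \<open>H\<close> of pairs. The minorant
is the infimal convolution \<open>v \<mapsto> inf {N (v - c) + \<alpha> | (c, \<alpha>) \<in> H}\<close>. It is sublinear because \<open>H\<close>
is a convex cone, and the hypothesis on \<open>H\<close> keeps the infimum above \<open>- N (- v)\<close>.\<close>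

lemma sublinear_minorant_along_cone:
  fixes N :: "'a::real_vector \<Rightarrow> real" and H :: "('a \<times> real) set"
  assumes N: "sublinear N" and H: "convex_cone H"
    and dom: "\<And>c \<alpha>. (c, \<alpha>) \<in> H \<Longrightarrow> - N (- c) \<le> \<alpha>"
  obtains g where "sublinear g" "g \<le> N" "\<And>c \<alpha>. (c, \<alpha>) \<in> H \<Longrightarrow> g c \<le> \<alpha>"
proof -
  define A where "A v = (\<lambda>(c, \<alpha>). N (v - c) + \<alpha>) ` H" for v
  define g where "g v = Inf (A v)" for v
  have A_I: "N (v - c) + \<alpha> \<in> A v" if "(c, \<alpha>) \<in> H" for v c \<alpha>
    using that unfolding A_def by force
  have zero: "(0, 0) \<in> H"
    using convex_cone_contains_0[OF H] by (simp add: zero_prod_def)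
  have lower: "- N (- v) \<le> z" if z: "z \<in> A v" for v z
  proof -
    obtain c \<alpha> where c: "(c, \<alpha>) \<in> H" "z = N (v - c) + \<alpha>"
      using z unfolding A_def by auto
    show ?thesis
      using dom[OF c(1)] sublinear_add[OF N, of "v - c" "- v"] c(2) by simp
  qed
  have bdd: "bdd_below (A v)" for v
    using lower by (meson bdd_belowI)
  have ne: "A v \<noteq> {}" for v
    using A_I[OF zero] by blast
  have g_le: "g v \<le> N (v - c) + \<alpha>" if "(c, \<alpha>) \<in> H" for v c \<alpha>
    unfolding g_def by (rule cInf_lower[OF A_I[OF that] bdd])
  have g_ge: "z \<le> g v" if "\<And>c \<alpha>. (c, \<alpha>) \<in> H \<Longrightarrow> z \<le> N (v - c) + \<alpha>" for v z
    unfolding g_def using that by (intro cInf_greatest[OF ne]) (auto simp: A_def)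
  show thesis
  proof
    show "sublinear g"
      unfolding sublinear_def
    proof (intro conjI allI impI)
      fix v w
      have "g (v + w) - (N (v - c) + \<alpha>) \<le> N (w - d) + \<beta>"
        if "(c, \<alpha>) \<in> H" "(d, \<beta>) \<in> H" for c \<alpha> d \<beta>
      proof -
        have "(c + d, \<alpha> + \<beta>) \<in> H"
          using convex_cone_add[OF H that] by simp
        from g_le[OF this, of "v + w"] show ?thesis
          using sublinear_add[OF N, of "v - c" "w - d"] by (simp add: algebra_simps)
      qed
      then have "g (v + w) - (N (v - c) + \<alpha>) \<le> g w" if "(c, \<alpha>) \<in> H" for c \<alpha>
        using that by (intro g_ge) auto
      then have "g (v + w) - g w \<le> N (v - c) + \<alpha>" if "(c, \<alpha>) \<in> H" for c \<alpha>
        using that by force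
      then have "g (v + w) - g w \<le> g v"
        by (rule g_ge)
      then show "g (v + w) \<le> g v + g w" by simp
    next
      fix t :: real and v :: 'a
      assume t: "0 < t"
      have "g (t *\<^sub>R v) / t \<le> N (v - c) + \<alpha>" if "(c, \<alpha>) \<in> H" for c \<alpha>
      proof -
        have "(t *\<^sub>R c, t * \<alpha>) \<in> H"
          using convex_cone_scaleR[OF H _ that, of t] t by simp
        from g_le[OF this, of "t *\<^sub>R v"] have "g (t *\<^sub>R v) \<le> t * (N (v - c) + \<alpha>)"
          using sublinear_scaleR_le[OF N t, of "v - c"] by (simp add: algebra_simps)
        then show ?thesis
          using t by (simp add: field_simps)
      qed
      then have "g (t *\<^sub>R v) / t \<le> g v"
        by (rule g_ge)
      then show "g (t *\<^sub>R v) \<le> t * g v"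
        using t by (simp add: field_simps)
    qed
    show "g \<le> N"
      using g_le[OF zero] by (simp add: le_fun_def)
    show "g c \<le> \<alpha>" if "(c, \<alpha>) \<in> H" for c \<alpha>
      using g_le[OF that, of c] sublinear_zero[OF N] by simp
  qed
qed

text \<open>Zorn's lemma: along a chain of sublinear functionals below \<open>N\<close>, all values at \<open>v\<close> stay above
\<open>- N (- v)\<close>, so the pointwise infimum exists; it is subadditive because of any two members of the
chain the smaller one bounds both summands.\<close>

lemma exists_minimal_sublinear:
  fixes N :: "'a::real_vector \<Rightarrow> real"
  assumes N: "sublinear N"
  obtains f where "sublinear f" "f \<le> N" "\<And>g. sublinear g \<Longrightarrow> g \<le> f \<Longrightarrow> g = f"
proof -
  define A where "A = {g. sublinear g \<and> g \<le> N}"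
  have "\<exists>f\<in>A. \<forall>g\<in>A. f \<ge> g \<longrightarrow> g = f"
  proof (rule predicate_Zorn)
    show "partial_order_on A (relation_of (\<ge>) A)"
      by (rule partial_order_on_relation_ofI) auto
    fix C
    assume C: "C \<in> Chains (relation_of (\<ge>) A)"
    then have chain: "g \<le> h \<or> h \<le> g" if "g \<in> C" "h \<in> C" for g h
      using that by (auto simp: Chains_def relation_of_def)
    have CA: "C \<subseteq> A"
      using C by (rule Chains_relation_of)
    show "\<exists>u\<in>A. \<forall>g\<in>C. g \<ge> u"
    proof (cases "C = {}")
      case True
      then show ?thesis
        using N by (auto simp: A_def)
    next
      case False
      define u where "u v = (INF g\<in>C. g v)" for v
      have bdd: "bdd_below ((\<lambda>g. g v) ` C)" for v
      proof (rule bdd_belowI2)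
        fix g
        assume "g \<in> C"
        with CA have g: "sublinear g" "g \<le> N"
          by (auto simp: A_def)
        show "- N (- v) \<le> g v"
          using sublinear_neg_le[OF g(1), of v] le_funD[OF g(2), of "- v"] by linarith
      qed
      have u_le: "u v \<le> g v" if "g \<in> C" for g v
        unfolding u_def by (rule cINF_lower[OF bdd that])
      have u_ge: "z \<le> u v" if "\<And>g. g \<in> C \<Longrightarrow> z \<le> g v" for z v
        unfolding u_def using False that by (intro cINF_greatest) auto
      have "sublinear u"
        unfolding sublinear_def
      proof (intro conjI allI impI)
        fix v w
        have "u (v + w) - g v \<le> h w" if gh: "g \<in> C" "h \<in> C" for g h
        proof -
          obtain k where k: "k \<in> C" "k \<le> g" "k \<le> h"
            using chain[OF gh] gh by blast
          have "u (v + w) \<le> k v + k w"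
            using u_le[OF k(1), of "v + w"] sublinear_add[of k v w] CA k(1)
            by (force simp: A_def)
          then show ?thesis
            using le_funD[OF k(2), of v] le_funD[OF k(3), of w] by linarith
        qed
        then have "u (v + w) - g v \<le> u w" if "g \<in> C" for g
          using that by (intro u_ge)
        then have "u (v + w) - u w \<le> g v" if "g \<in> C" for g
          using that by force
        then have "u (v + w) - u w \<le> u v"
          by (rule u_ge)
        then show "u (v + w) \<le> u v + u w" by simp
      next
        fix t :: real and v :: 'a
        assume t: "0 < t"
        have "u (t *\<^sub>R v) / t \<le> g v" if g: "g \<in> C" for g
        proof -
          have "u (t *\<^sub>R v) \<le> t * g v"
            using u_le[OF g, of "t *\<^sub>R v"] sublinear_scaleR_le[OF _ t, of g v] CA g
            by (force simp: A_def)
          then show ?thesis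
            using t by (simp add: field_simps)
        qed
        then have "u (t *\<^sub>R v) / t \<le> u v"
          by (rule u_ge)
        then show "u (t *\<^sub>R v) \<le> t * u v"
          using t by (simp add: field_simps)
      qed
      moreover have "u \<le> N"
      proof (rule le_funI)
        fix v
        obtain g where g: "g \<in> C"
          using False by blast
        then have "g \<le> N"
          using CA by (auto simp: A_def)
        then show "u v \<le> N v"
          using u_le[OF g, of v] le_funD[of g N v] by linarith
      qed
      ultimately have "u \<in> A"
        by (simp add: A_def)
      moreover have "\<forall>g\<in>C. u \<le> g"
        using u_le by (simp add: le_fun_def)
      ultimately show ?thesis
        by blast
    qed
  qed
  then obtain f where f: "f \<in> A" "\<And>g. g \<in> A \<Longrightarrow> g \<le> f \<Longrightarrow> g = f"
    by blast
  show thesis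
  proof
    show "sublinear f" "f \<le> N"
      using f(1) by (auto simp: A_def)
    show "g = f" if "sublinear g" "g \<le> f" for g
      using that f by (auto simp: A_def intro: order_trans)
  qed
qed

text \<open>Lowering \<open>f\<close> along the ray through \<open>- x\<close> to the value \<open>- f x\<close> there is always admissible. A
minimal \<open>f\<close> does not change, hence is odd, and an odd sublinear functional is linear.\<close>

lemma minimal_sublinear_linear:
  fixes f :: "'a::real_vector \<Rightarrow> real"
  assumes f: "sublinear f" and minimal: "\<And>g. sublinear g \<Longrightarrow> g \<le> f \<Longrightarrow> g = f"
  shows "linear f"
proof -
  have odd: "f (- x) = - f x" for x
  proof -
    define H where "H = (\<lambda>t. (- (t *\<^sub>R x), - (t * f x))) ` {0..}"
    have "convex_cone H"
      unfolding convex_cone_iff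
    proof (intro conjI ballI allI impI)
      show "0 \<in> H"
        unfolding H_def by (intro image_eqI[where x=0]) (auto simp: zero_prod_def)
    next
      fix a b
      assume "a \<in> H" "b \<in> H"
      then obtain s t where "0 \<le> s" "0 \<le> t" "a = (- (s *\<^sub>R x), - (s * f x))"
          "b = (- (t *\<^sub>R x), - (t * f x))"
        by (auto simp: H_def)
      then show "a + b \<in> H"
        unfolding H_def by (intro image_eqI[where x="s + t"]) (auto simp: algebra_simps)
    next
      fix a and c :: real
      assume "a \<in> H" "0 \<le> c"
      then obtain s where "0 \<le> s" "a = (- (s *\<^sub>R x), - (s * f x))"
        by (auto simp: H_def)
      then show "c *\<^sub>R a \<in> H"
        unfolding H_def using \<open>0 \<le> c\<close> by (intro image_eqI[where x="c * s"]) auto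
    qed
    moreover have "- f (- c) \<le> \<alpha>" if "(c, \<alpha>) \<in> H" for c \<alpha>
      using that sublinear_scaleR[OF f] by (auto simp: H_def)
    ultimately obtain g where g: "sublinear g" "g \<le> f" "\<And>c \<alpha>. (c, \<alpha>) \<in> H \<Longrightarrow> g c \<le> \<alpha>"
      using sublinear_minorant_along_cone[OF f] by metis
    have "(- x, - f x) \<in> H"
      unfolding H_def by (intro image_eqI[where x=1]) auto
    then have "f (- x) \<le> - f x"
      using g(3) minimal[OF g(1,2)] by simp
    then show ?thesis
      using sublinear_neg_le[OF f, of x] by linarith
  qed
  show ?thesis
  proof (rule linearI)
    fix v w
    have "f (v + w + - w) \<le> f (v + w) + f (- w)"
      by (rule sublinear_add[OF f])
    then show "f (v + w) = f v + f w"
      using sublinear_add[OF f, of v w] odd[of w] by simp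
  next
    fix t v
    show "f (t *\<^sub>R v) = t *\<^sub>R f v"
    proof (cases "0 \<le> t")
      case True
      then show ?thesis using sublinear_scaleR[OF f] by simp
    next
      case False
      then have "f (- ((- t) *\<^sub>R v)) = - (- t * f v)"
        using sublinear_scaleR[OF f, of "- t" v] odd[of "(- t) *\<^sub>R v"] by simp
      then show ?thesis by simp
    qed
  qed
qed

text \<open>With \<open>H\<close> the graph of a linear functional on a subspace this is the usual dominated extension.
The form with a cone allows equalities and inequalities to be prescribed together.\<close>

lemma hahn_banach_cone:
  fixes N :: "'a::real_vector \<Rightarrow> real" and H :: "('a \<times> real) set"
  assumes N: "sublinear N" and H: "convex_cone H"
    and dom: "\<And>c \<alpha>. (c, \<alpha>) \<in> H \<Longrightarrow> - N (- c) \<le> \<alpha>"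
  obtains f where "linear f" "f \<le> N" "\<And>c \<alpha>. (c, \<alpha>) \<in> H \<Longrightarrow> f c \<le> \<alpha>"
proof -
  obtain g where g: "sublinear g" "g \<le> N" "\<And>c \<alpha>. (c, \<alpha>) \<in> H \<Longrightarrow> g c \<le> \<alpha>"
    using sublinear_minorant_along_cone[OF N H dom] by metis
  obtain f where f: "sublinear f" "f \<le> g" "\<And>h. sublinear h \<Longrightarrow> h \<le> f \<Longrightarrow> h = f"
    using exists_minimal_sublinear[OF g(1)] by metis
  show thesis
  proof
    show "linear f"
      using minimal_sublinear_linear[OF f(1,3)] .
    show "f \<le> N"
      using f(2) g(2) by (rule order_trans)
    show "f c \<le> \<alpha>" if "(c, \<alpha>) \<in> H" for c \<alpha>
      using le_funD[OF f(2), of c] g(3)[OF that] by linarith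
  qed
qed

lemma J1_apply_le:
  assumes "p \<in> J1 x"
  shows "\<bar>blinfun_apply p v\<bar> \<le> norm v"
  using norm_blinfun[of p v] assms by (simp add: J1_def)

text \<open>James' characterisation. For the converse direction the conditions \<open>f (- x) \<le> - norm x\<close>
and \<open>f (\<plusminus> y) \<le> 0\<close> generate the cone of all \<open>(s *\<^sub>R y - t *\<^sub>R x, - (t * norm x))\<close> with \<open>t \<ge> 0\<close>,
and compatibility of this cone with the norm is exactly Birkhoff--James orthogonality.\<close>

lemma J1_annihilating_iff_birkhoff_orthogonal:
  fixes x y :: "'a::real_normed_vector"
  assumes x: "x \<noteq> 0"
  shows "(\<exists>p\<in>J1 x. blinfun_apply p y = 0) \<longleftrightarrow> (\<forall>s. norm x \<le> norm (x + s *\<^sub>R y))"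
proof
  assume "\<exists>p\<in>J1 x. blinfun_apply p y = 0"
  then obtain p where p: "p \<in> J1 x" "blinfun_apply p y = 0" by blast
  show "\<forall>s. norm x \<le> norm (x + s *\<^sub>R y)"
  proof
    fix s
    show "norm x \<le> norm (x + s *\<^sub>R y)"
      using J1_apply_le[OF p(1), of "x + s *\<^sub>R y"] p
      by (simp add: J1_def blinfun.add_right blinfun.scaleR_right)
  qed
next
  assume orth: "\<forall>s. norm x \<le> norm (x + s *\<^sub>R y)"
  define H where "H = (\<lambda>(t, s). (s *\<^sub>R y - t *\<^sub>R x, - (t * norm x))) ` ({0..} \<times> UNIV)"
  have cone: "convex_cone H"
    unfolding convex_cone_iff
  proof (intro conjI ballI allI impI)
    show "0 \<in> H"
      unfolding H_def by (intro image_eqI[where x="(0, 0)"]) (auto simp: zero_prod_def)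
  next
    fix a b
    assume "a \<in> H" "b \<in> H"
    then obtain t s t' s' where "0 \<le> t" "0 \<le> t'" "a = (s *\<^sub>R y - t *\<^sub>R x, - (t * norm x))"
        "b = (s' *\<^sub>R y - t' *\<^sub>R x, - (t' * norm x))"
      by (auto simp: H_def)
    then show "a + b \<in> H"
      unfolding H_def by (intro image_eqI[where x="(t + t', s + s')"]) (auto simp: algebra_simps)
  next
    fix a and c :: real
    assume "a \<in> H" "0 \<le> c"
    then obtain t s where "0 \<le> t" "a = (s *\<^sub>R y - t *\<^sub>R x, - (t * norm x))"
      by (auto simp: H_def)
    then show "c *\<^sub>R a \<in> H"
      unfolding H_def using \<open>0 \<le> c\<close>
      by (intro image_eqI[where x="(c * t, c * s)"]) (auto simp: algebra_simps)
  qed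
  have dom: "- norm (- c) \<le> \<alpha>" if mem: "(c, \<alpha>) \<in> H" for c \<alpha>
  proof -
    obtain t s where ts: "0 \<le> t" "c = s *\<^sub>R y - t *\<^sub>R x" "\<alpha> = - (t * norm x)"
      using mem by (auto simp: H_def)
    have "t * norm x \<le> norm c"
    proof (cases "t = 0")
      case False
      have "c = - (t *\<^sub>R (x + (- s / t) *\<^sub>R y))"
        using False by (simp add: ts(2) scaleR_diff_right)
      then have "norm c = norm (t *\<^sub>R (x + (- s / t) *\<^sub>R y))"
        by (metis norm_minus_cancel)
      also have "\<dots> = t * norm (x + (- s / t) *\<^sub>R y)"
        using ts(1) by simp
      finally show ?thesis
        using mult_left_mono[OF orth[rule_format, of "- s / t"] ts(1)] by simp
    qed simp
    then show ?thesis
      using ts(3) by simp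
  qed
  obtain f where f: "linear f" "f \<le> norm" "\<And>c \<alpha>. (c, \<alpha>) \<in> H \<Longrightarrow> f c \<le> \<alpha>"
    using hahn_banach_cone[OF sublinear_norm cone dom] by blast
  have f_abs: "\<bar>f v\<bar> \<le> norm v" for v
    using le_funD[OF f(2), of v] le_funD[OF f(2), of "- v"] linear_neg[OF f(1), of v] by simp
  have "bounded_linear f"
    using f(1) f_abs by (auto simp: bounded_linear_def bounded_linear_axioms_def intro!: exI[of _ 1])
  then obtain p where p: "blinfun_apply p = f"
    using bounded_linear_Blinfun_apply by blast
  have "f (- x) \<le> - norm x"
    by (rule f(3)) (auto simp: H_def intro!: image_eqI[where x="(1, 0)"])
  then have fx: "f x = norm x"
    using f_abs[of x] linear_neg[OF f(1), of x] by simp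
  have "f y \<le> 0"
    by (rule f(3)) (auto simp: H_def intro!: image_eqI[where x="(0, 1)"])
  moreover have "f (- y) \<le> 0"
    by (rule f(3)) (auto simp: H_def intro!: image_eqI[where x="(0, - 1)"])
  ultimately have fy: "f y = 0"
    using linear_neg[OF f(1), of y] by simp
  have "norm p \<le> 1"
    using f_abs by (intro norm_blinfun_bound) (auto simp: p)
  moreover have "norm x \<le> norm p * norm x"
    using norm_blinfun[of p x] fx by (simp add: p)
  then have "1 \<le> norm p"
    using x by simp
  ultimately have "p \<in> J1 x"
    using fx by (simp add: J1_def p)
  then show "\<exists>p\<in>J1 x. blinfun_apply p y = 0"
    using fy p by auto
qed

lemma J1_nonempty:
  fixes x :: "'a::real_normed_vector"
  assumes "x \<noteq> 0"
  shows "J1 x \<noteq> {}"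
  using J1_annihilating_iff_birkhoff_orthogonal[OF assms, of 0] by auto

section \<open>Quasiorthogonal unit vectors\<close>

lemma quasiorthogonal_iff_birkhoff_orthogonal:
  fixes x y :: "'a::real_normed_vector"
  assumes "x \<noteq> 0"
  shows "quasiorthogonal y x \<longleftrightarrow> (\<forall>s. norm x \<le> norm (x + s *\<^sub>R y))"
  using J1_annihilating_iff_birkhoff_orthogonal[OF assms, of y] assms
  by (simp add: quasiorthogonal_def)

lemma quasiorthogonal_uminus_left:
  "quasiorthogonal y x \<Longrightarrow> quasiorthogonal (- y) x"
  by (auto simp: quasiorthogonal_def blinfun.minus_right)

lemma quasiorthogonal_norm_ge:
  assumes "quasiorthogonal y x" "norm x = 1"
  shows "\<bar>a\<bar> \<le> norm (a *\<^sub>R x + b *\<^sub>R y)"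
proof -
  obtain p where p: "p \<in> J1 x" "blinfun_apply p y = 0"
    using assms(1) by (auto simp: quasiorthogonal_def)
  then show ?thesis
    using J1_apply_le[OF p(1), of "a *\<^sub>R x + b *\<^sub>R y"] assms(2)
    by (simp add: J1_def blinfun.add_right blinfun.scaleR_right)
qed

text \<open>Without such a pair the infimum that defines \<open>\<lambda>\<^sup>-\<close> would range over the empty set; this is where
dimension at least two enters.\<close>

lemma exists_quasiorthogonal_unit_pair:
  assumes "\<exists>B :: 'a::real_normed_vector set. independent B \<and> card B = 2"
  obtains x y :: "'a::real_normed_vector" where "norm x = 1" "norm y = 1" "quasiorthogonal y x"
proof -
  obtain u v :: 'a where uv: "independent {u, v}" "u \<noteq> v"
    using assms by (metis card_2_iff)
  have "u \<noteq> 0"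
    using uv dependent_zero[of "{u, v}"] by auto
  then obtain p where p: "p \<in> J1 u"
    using J1_nonempty by blast
  define w where "w = v - (blinfun_apply p v / norm u) *\<^sub>R u"
  have "w \<noteq> 0"
  proof
    assume "w = 0"
    then have "v \<in> span {u}"
      unfolding w_def by (simp add: span_singleton)
    then show False
      using uv independent_insert[of v "{u}"] by (simp add: insert_commute)
  qed
  have "blinfun_apply p w = 0"
    using p \<open>u \<noteq> 0\<close> by (simp add: w_def J1_def blinfun.diff_right blinfun.scaleR_right)
  moreover have "p \<in> J1 (u /\<^sub>R norm u)"
    using p \<open>u \<noteq> 0\<close> by (simp add: J1_def blinfun.scaleR_right)
  ultimately have "quasiorthogonal (w /\<^sub>R norm w) (u /\<^sub>R norm u)"
    using \<open>u \<noteq> 0\<close> by (auto simp: quasiorthogonal_def blinfun.scaleR_right)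
  then show thesis
    using that[of "u /\<^sub>R norm u" "w /\<^sub>R norm w"] \<open>u \<noteq> 0\<close> \<open>w \<noteq> 0\<close> by simp
qed

text \<open>The point of \<open>e + \<real> y\<close> nearest to the origin, normalised to \<open>x\<close>. Minimality of its norm is
Birkhoff--James orthogonality of \<open>x\<close> to \<open>y\<close>. A functional supporting the ball at \<open>y\<close> and
annihilating \<open>e\<close> confines the minimisation to a compact interval.\<close>

lemma nearest_point_on_line:
  fixes y e :: "'a::real_normed_vector"
  assumes y: "norm y = 1" and e: "norm e = 1" and orth: "quasiorthogonal e y"
  obtains x b d where "0 < d" "d \<le> 1" "norm x = 1" "d *\<^sub>R x = e + b *\<^sub>R y"
    "quasiorthogonal y x" "\<And>s. d \<le> norm (e + s *\<^sub>R y)"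
proof -
  have coord: "\<bar>s\<bar> \<le> norm (e + s *\<^sub>R y)" for s
    using quasiorthogonal_norm_ge[OF orth y, of s 1] by (simp add: add.commute)
  obtain b where b: "\<And>s. s \<in> {-2..2} \<Longrightarrow> norm (e + b *\<^sub>R y) \<le> norm (e + s *\<^sub>R y)"
  proof -
    have "continuous_on {-2..2} (\<lambda>s. norm (e + s *\<^sub>R y))"
      by (intro continuous_intros)
    then show thesis
      using continuous_attains_inf[of "{-2..2::real}" "\<lambda>s. norm (e + s *\<^sub>R y)"] that
      by (metis atLeastAtMost_iff compact_Icc equals0D neg_le_0_iff_le zero_le_numeral)
  qed
  define d where "d = norm (e + b *\<^sub>R y)"
  have d1: "d \<le> 1"
    using b[of 0] e by (simp add: d_def)
  have min: "d \<le> norm (e + s *\<^sub>R y)" for s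
  proof (cases "s \<in> {-2..2}")
    case True
    then show ?thesis using b by (simp add: d_def)
  next
    case False
    then show ?thesis using coord[of s] d1 by auto
  qed
  have "d \<noteq> 0"
  proof
    assume "d = 0"
    then have "e + b *\<^sub>R y = 0" "b = 0"
      using coord[of b] by (auto simp: d_def)
    then show False using e by simp
  qed
  then have d0: "0 < d"
    by (simp add: d_def)
  define x where "x = (e + b *\<^sub>R y) /\<^sub>R d"
  have x1: "norm x = 1"
    using d0 by (simp add: x_def d_def)
  have dx: "d *\<^sub>R x = e + b *\<^sub>R y"
    using d0 by (simp add: x_def)
  have "1 \<le> norm (x + s *\<^sub>R y)" for s
  proof -
    have "d *\<^sub>R (x + s *\<^sub>R y) = e + (b + d * s) *\<^sub>R y"
      by (simp add: scaleR_add_right scaleR_add_left dx)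
    then have "d \<le> d * norm (x + s *\<^sub>R y)"
      using min[of "b + d * s"] d0 by (metis abs_of_pos norm_scaleR)
    then show ?thesis
      using d0 by simp
  qed
  then have "quasiorthogonal y x"
    using quasiorthogonal_iff_birkhoff_orthogonal[of x y] x1 by force
  then show thesis
    using that[OF d0 d1 x1 dx] min by blast
qed

section \<open>The supporting depth\<close>

text \<open>The functional supporting the ball at \<open>x\<close> shows that the norm is at least \<open>1\<close> at \<open>l = 0\<close> and
greater than \<open>1\<close> for \<open>l < 0\<close>. So by the intermediate value theorem every \<open>l\<close> for which the point
is in the ball has a hitting parameter at or below it; the set of these parameters is closed and
contains its infimum.\<close>

lemma supp_lambda_hits_first:
  fixes x y :: "'a::real_normed_vector"
  assumes x: "norm x = 1" and y: "norm y = 1" and orth: "quasiorthogonal y x"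
    and r: "0 \<le> r" "r \<le> 1"
  shows supp_lambda_norm: "norm (x + r *\<^sub>R y - supp_lambda x y r *\<^sub>R x) = 1"
    and supp_lambda_le: "\<And>l. norm (x + r *\<^sub>R y - l *\<^sub>R x) \<le> 1 \<Longrightarrow> supp_lambda x y r \<le> l"
    and supp_lambda_nonneg: "0 \<le> supp_lambda x y r"
    and supp_lambda_le_self: "supp_lambda x y r \<le> r"
proof -
  define g where "g l = norm (x + r *\<^sub>R y - l *\<^sub>R x)" for l
  have g_ge: "\<bar>1 - l\<bar> \<le> g l" for l
    using quasiorthogonal_norm_ge[OF orth x, of "1 - l" r] by (simp add: g_def algebra_simps)
  have cont: "continuous_on A g" for A
    unfolding g_def by (intro continuous_intros)
  have below: "\<exists>l'\<le>l. g l' = 1" if "g l \<le> 1" for l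
  proof -
    have "0 \<le> l"
      using g_ge[of l] that by linarith
    then show ?thesis
      using IVT2'[of g l 1 0] cont that g_ge[of 0] by auto
  qed
  have "g r \<le> norm ((1 - r) *\<^sub>R x) + norm (r *\<^sub>R y)"
    using norm_triangle_ineq[of "(1 - r) *\<^sub>R x" "r *\<^sub>R y"] by (simp add: g_def algebra_simps)
  then have gr: "g r \<le> 1"
    using r x y by simp
  define S where "S = {l. g l = 1}"
  have lower: "0 \<le> l" if "l \<in> S" for l
    using g_ge[of l] that by (auto simp: S_def)
  have bdd: "bdd_below S"
    using lower by (rule bdd_belowI)
  have "S \<noteq> {}"
    using below[OF gr] by (auto simp: S_def)
  moreover have "closed S"
    unfolding S_def by (intro closed_Collect_eq cont continuous_on_const)
  ultimately have "Inf S \<in> S"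
    using bdd by (intro closed_contains_Inf)
  moreover have "supp_lambda x y r = (LEAST l. l \<in> S)"
    by (simp add: supp_lambda_def S_def g_def)
  ultimately have eq: "supp_lambda x y r = Inf S"
    using bdd by (auto intro: Least_equality cInf_lower)
  show "norm (x + r *\<^sub>R y - supp_lambda x y r *\<^sub>R x) = 1"
    using \<open>Inf S \<in> S\<close> eq by (simp add: S_def g_def)
  show le: "supp_lambda x y r \<le> l" if l: "norm (x + r *\<^sub>R y - l *\<^sub>R x) \<le> 1" for l
  proof -
    obtain l' where "l' \<le> l" "l' \<in> S"
      using below[of l] l by (auto simp: S_def g_def)
    then show ?thesis
      using cInf_lower[OF _ bdd, of l'] eq by simp
  qed
  show "0 \<le> supp_lambda x y r"
    using lower[OF \<open>Inf S \<in> S\<close>] eq by simp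
  show "supp_lambda x y r \<le> r"
    using le gr by (simp add: g_def)
qed

text \<open>The norm is convex along the ray and equals \<open>r < 1\<close> at \<open>l = 1\<close>. Hence the ray stays
in the open ball between its first hit and \<open>l = 1\<close>.\<close>

lemma supp_lambda_ge:
  fixes x y :: "'a::real_normed_vector"
  assumes x: "norm x = 1" and y: "norm y = 1" and orth: "quasiorthogonal y x"
    and r: "0 \<le> r" "r < 1" and l: "l < 1" and outside: "1 \<le> norm (x + r *\<^sub>R y - l *\<^sub>R x)"
  shows "l \<le> supp_lambda x y r"
proof (rule ccontr)
  define m where "m = supp_lambda x y r"
  assume "\<not> l \<le> supp_lambda x y r"
  then have m: "m < l" by (simp add: m_def)
  define \<theta> where "\<theta> = (l - m) / (1 - m)"
  have \<theta>: "0 < \<theta>" "\<theta> < 1"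
    using m l by (auto simp: \<theta>_def field_simps)
  have "\<theta> * (1 - m) = l - m"
    using m l by (simp add: \<theta>_def)
  then have "(1 - \<theta>) * (1 - m) = 1 - l"
    by (simp add: algebra_simps)
  moreover have "(1 - \<theta>) *\<^sub>R (x + r *\<^sub>R y - m *\<^sub>R x) + \<theta> *\<^sub>R (r *\<^sub>R y)
      = ((1 - \<theta>) * (1 - m)) *\<^sub>R x + r *\<^sub>R y"
    by (simp add: algebra_simps)
  moreover have "(1 - l) *\<^sub>R x + r *\<^sub>R y = x + r *\<^sub>R y - l *\<^sub>R x"
    by (simp add: algebra_simps)
  ultimately have "x + r *\<^sub>R y - l *\<^sub>R x
      = (1 - \<theta>) *\<^sub>R (x + r *\<^sub>R y - m *\<^sub>R x) + \<theta> *\<^sub>R (r *\<^sub>R y)"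
    by metis
  then have "norm (x + r *\<^sub>R y - l *\<^sub>R x)
      \<le> (1 - \<theta>) * norm (x + r *\<^sub>R y - m *\<^sub>R x) + \<theta> * norm (r *\<^sub>R y)"
    using norm_triangle_ineq[of "(1 - \<theta>) *\<^sub>R (x + r *\<^sub>R y - m *\<^sub>R x)" "\<theta> *\<^sub>R (r *\<^sub>R y)"] \<theta>
    by (simp add: abs_mult)
  also have "\<dots> = (1 - \<theta>) + \<theta> * r"
    using supp_lambda_norm[OF x y orth, of r] r y by (simp add: m_def)
  also have "\<dots> < 1"
    using \<theta> r by simp
  finally show False
    using outside by simp
qed

text \<open>Moving the point \<open>x + s *\<^sub>R y - l *\<^sub>R x\<close> of the ball towards the unit vector \<open>y\<close>, by the
fraction \<open>(r - s) / (1 - s)\<close>, raises its \<open>y\<close>-coordinate from \<open>s\<close> to \<open>r\<close>. This costs in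
depth at most that fraction, which is at most \<open>2 * (r - s)\<close> because \<open>s \<le> 1 / 2\<close>.\<close>

lemma supp_lambda_slope_le:
  fixes x y :: "'a::real_normed_vector"
  assumes x: "norm x = 1" and y: "norm y = 1" and orth: "quasiorthogonal y x"
    and r: "0 \<le> s" "s \<le> r" "r \<le> 1 / 2" and l: "0 \<le> l"
    and inside: "norm (x + s *\<^sub>R y - l *\<^sub>R x) \<le> 1"
  shows "supp_lambda x y r \<le> l + 2 * (r - s)"
proof -
  define \<theta> where "\<theta> = (r - s) / (1 - s)"
  have \<theta>: "0 \<le> \<theta>" "\<theta> \<le> 1" "\<theta> * (1 - s) = r - s"
    using r by (auto simp: \<theta>_def field_simps)
  have "\<theta> * (1 / 2) \<le> \<theta> * (1 - s)"
    using \<theta>(1) r by (intro mult_left_mono) auto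
  then have \<theta>2: "\<theta> \<le> 2 * (r - s)"
    using \<theta>(3) by simp
  have coeff: "(1 - \<theta>) * s + \<theta> = r"
    using \<theta>(3) by (simp add: algebra_simps)
  have "(1 - \<theta>) *\<^sub>R (x + s *\<^sub>R y - l *\<^sub>R x) + \<theta> *\<^sub>R y
      = x + ((1 - \<theta>) * s + \<theta>) *\<^sub>R y - (l + \<theta> - \<theta> * l) *\<^sub>R x"
    by (simp add: algebra_simps)
  also have "\<dots> = x + r *\<^sub>R y - (l + \<theta> - \<theta> * l) *\<^sub>R x"
    by (simp add: coeff)
  finally have "norm (x + r *\<^sub>R y - (l + \<theta> - \<theta> * l) *\<^sub>R x)
      \<le> (1 - \<theta>) * norm (x + s *\<^sub>R y - l *\<^sub>R x) + \<theta> * norm y"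
    using norm_triangle_ineq[of "(1 - \<theta>) *\<^sub>R (x + s *\<^sub>R y - l *\<^sub>R x)" "\<theta> *\<^sub>R y"] \<theta>(1,2)
    by simp
  also have "\<dots> \<le> (1 - \<theta>) * 1 + \<theta>"
    using \<theta>(1,2) y inside by (intro add_mono mult_left_mono) auto
  finally have "supp_lambda x y r \<le> l + \<theta> - \<theta> * l"
    using r by (intro supp_lambda_le[OF x y orth]) auto
  also have "\<dots> \<le> l + \<theta>"
    using \<theta>(1) l by simp
  finally show ?thesis
    using \<theta>2 by simp
qed

section \<open>Bounds for the moduli and for the norms of projections\<close>

lemma supp_convexity_modulus_le:
  fixes x y :: "'a::real_normed_vector"
  assumes "norm x = 1" "norm y = 1" "quasiorthogonal y x" "0 \<le> r" "r \<le> 1"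
  shows "supp_convexity_modulus TYPE('a) r \<le> supp_lambda x y r"
  unfolding supp_convexity_modulus_def
proof (rule cInf_lower)
  show "bdd_below {supp_lambda x y r |x y :: 'a. norm x = 1 \<and> norm y = 1 \<and> quasiorthogonal y x}"
    using supp_lambda_nonneg assms(4,5) by (auto intro!: bdd_belowI[of _ 0])
qed (use assms in blast)

lemma supp_convexity_modulus_ge:
  assumes "\<exists>B :: 'a::real_normed_vector set. independent B \<and> card B = 2"
    and "\<And>x y :: 'a. norm x = 1 \<Longrightarrow> norm y = 1 \<Longrightarrow> quasiorthogonal y x \<Longrightarrow> c \<le> supp_lambda x y r"
  shows "c \<le> supp_convexity_modulus TYPE('a) r"
  unfolding supp_convexity_modulus_def
proof (rule cInf_greatest)
  obtain x y :: 'a where "norm x = 1" "norm y = 1" "quasiorthogonal y x"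
    using exists_quasiorthogonal_unit_pair[OF assms(1)] .
  then show "{supp_lambda x y r |x y :: 'a. norm x = 1 \<and> norm y = 1 \<and> quasiorthogonal y x} \<noteq> {}"
    by blast
qed (use assms(2) in blast)

lemma supp_convexity_modulus_bounds:
  assumes "\<exists>B :: 'a::real_normed_vector set. independent B \<and> card B = 2" "0 \<le> r" "r \<le> 1"
  shows "0 \<le> supp_convexity_modulus TYPE('a) r" "supp_convexity_modulus TYPE('a) r \<le> r"
proof -
  show "0 \<le> supp_convexity_modulus TYPE('a) r"
    using supp_lambda_nonneg assms(2,3) by (intro supp_convexity_modulus_ge[OF assms(1)]) blast
  obtain x y :: 'a where "norm x = 1" "norm y = 1" "quasiorthogonal y x"
    using exists_quasiorthogonal_unit_pair[OF assms(1)] .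
  then show "supp_convexity_modulus TYPE('a) r \<le> r"
    using supp_convexity_modulus_le[of x y r] supp_lambda_le_self[of x y r] assms(2,3) by linarith
qed

lemma supp_smoothness_modulus_ge:
  fixes x y :: "'a::real_normed_vector"
  assumes "norm x = 1" "norm y = 1" "quasiorthogonal y x" "0 \<le> r" "r \<le> 1"
  shows "supp_lambda x y r \<le> supp_smoothness_modulus TYPE('a) r"
  unfolding supp_smoothness_modulus_def
proof (rule cSup_upper)
  show "bdd_above {supp_lambda x y t |(x :: 'a) y t.
      norm x = 1 \<and> norm y = 1 \<and> quasiorthogonal y x \<and> 0 \<le> t \<and> t \<le> r}"
  proof (rule bdd_aboveI[of _ 1])
    fix m
    assume "m \<in> {supp_lambda x y t |(x :: 'a) y t.
      norm x = 1 \<and> norm y = 1 \<and> quasiorthogonal y x \<and> 0 \<le> t \<and> t \<le> r}"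
    then obtain x y :: 'a and t where "m = supp_lambda x y t" "norm x = 1" "norm y = 1"
        "quasiorthogonal y x" "0 \<le> t" "t \<le> r"
      by blast
    then show "m \<le> 1"
      using supp_lambda_le_self[of x y t] assms(5) by simp
  qed
qed (use assms in blast)

lemma supp_smoothness_modulus_le_self:
  assumes "\<exists>B :: 'a::real_normed_vector set. independent B \<and> card B = 2" "0 \<le> r" "r \<le> 1"
  shows "supp_smoothness_modulus TYPE('a) r \<le> r"
  unfolding supp_smoothness_modulus_def
proof (rule cSup_least)
  obtain x y :: 'a where "norm x = 1" "norm y = 1" "quasiorthogonal y x"
    using exists_quasiorthogonal_unit_pair[OF assms(1)] .
  then show "{supp_lambda x y t |(x :: 'a) y t.
      norm x = 1 \<and> norm y = 1 \<and> quasiorthogonal y x \<and> 0 \<le> t \<and> t \<le> r} \<noteq> {}"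
    using assms(2) by blast
  fix m
  assume "m \<in> {supp_lambda x y t |(x :: 'a) y t.
    norm x = 1 \<and> norm y = 1 \<and> quasiorthogonal y x \<and> 0 \<le> t \<and> t \<le> r}"
  then obtain x y :: 'a and t where "m = supp_lambda x y t" "norm x = 1" "norm y = 1"
      "quasiorthogonal y x" "0 \<le> t" "t \<le> r"
    by blast
  then show "m \<le> r"
    using supp_lambda_le_self[of x y t] assms(3) by simp
qed

lemma norm_projection_le:
  assumes "p \<in> J1 y" "norm x = 1" "norm y = 1"
  shows "norm (x - blinfun_apply p x *\<^sub>R y) \<le> 2"
  using norm_triangle_ineq4[of x "blinfun_apply p x *\<^sub>R y"] J1_apply_le[OF assms(1), of x] assms(2,3)
  by simp

text \<open>Both suprema in the definition of \<open>\<xi>\<close> are suprema of real numbers, so boundedness and, for the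
inner one, existence of a supporting functional have to be supplied.\<close>

lemma xi_ge:
  fixes x y :: "'a::real_normed_vector"
  assumes "norm x = 1" "norm y = 1" "p \<in> J1 y"
  shows "norm (x - blinfun_apply p x *\<^sub>R y) \<le> xi TYPE('a)"
proof -
  let ?f = "\<lambda>(x, y :: 'a). SUP p \<in> J1 y. norm (x - blinfun_apply p x *\<^sub>R y)"
  have "norm (x - blinfun_apply p x *\<^sub>R y) \<le> ?f (x, y)"
    using assms by (auto intro!: cSUP_upper bdd_aboveI2[of _ _ 2] norm_projection_le)
  also have "\<dots> \<le> xi TYPE('a)"
    unfolding xi_def
  proof (rule cSUP_upper)
    show "bdd_above (?f ` {(x, y). norm x = 1 \<and> norm y = 1})"
    proof (rule bdd_aboveI2[of _ _ 2])
      fix z :: "'a \<times> 'a"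
      assume "z \<in> {(x, y). norm x = 1 \<and> norm y = 1}"
      then obtain u v where z: "z = (u, v)" "norm u = 1" "norm v = 1"
        by auto
      then have "J1 v \<noteq> {}"
        by (intro J1_nonempty) auto
      then show "?f z \<le> 2"
        using z norm_projection_le by (auto intro!: cSUP_least)
    qed
  qed (use assms in simp)
  finally show ?thesis .
qed

lemma xi_le:
  assumes "\<exists>x :: 'a::real_normed_vector. norm x = 1"
    and "\<And>(x :: 'a) y p. norm x = 1 \<Longrightarrow> norm y = 1 \<Longrightarrow> p \<in> J1 y
      \<Longrightarrow> norm (x - blinfun_apply p x *\<^sub>R y) \<le> c"
  shows "xi TYPE('a) \<le> c"
  unfolding xi_def
proof (rule cSUP_least)
  show "{(x :: 'a, y :: 'a). norm x = 1 \<and> norm y = 1} \<noteq> {}"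
    using assms(1) by blast
  fix z :: "'a \<times> 'a"
  assume "z \<in> {(x, y). norm x = 1 \<and> norm y = 1}"
  then obtain u v where z: "z = (u, v)" "norm u = 1" "norm v = 1"
    by auto
  then have "J1 v \<noteq> {}"
    by (intro J1_nonempty) auto
  then show "(case z of (x, y) \<Rightarrow> SUP p \<in> J1 y. norm (x - blinfun_apply p x *\<^sub>R y)) \<le> c"
    using z assms(2) by (auto intro!: cSUP_least)
qed

section \<open>Chords parallel to a quasiorthogonal direction\<close>

text \<open>A functional supporting at \<open>y\<close> and annihilating \<open>e\<close> takes the value \<open>b / d\<close> at \<open>x\<close>, so it
projects \<open>x\<close> along \<open>y\<close> to \<open>e / d\<close>.\<close>

lemma xi_ge_inverse_distance:
  fixes x y e :: "'a::real_normed_vector"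
  assumes y: "norm y = 1" and e: "norm e = 1" and orth: "quasiorthogonal e y"
    and x: "norm x = 1" "0 < d" "d *\<^sub>R x = e + b *\<^sub>R y"
  shows "1 / d \<le> xi TYPE('a)"
proof -
  obtain p where p: "p \<in> J1 y" "blinfun_apply p e = 0"
    using orth by (auto simp: quasiorthogonal_def)
  have "d * blinfun_apply p x = b"
    using arg_cong[OF x(3), of "blinfun_apply p"] p y
    by (simp add: J1_def blinfun.add_right blinfun.scaleR_right)
  then have "d *\<^sub>R (x - blinfun_apply p x *\<^sub>R y) = e"
    by (simp add: scaleR_diff_right x(3))
  then have "d * norm (x - blinfun_apply p x *\<^sub>R y) = 1"
    using e x(2) by (metis abs_of_pos norm_scaleR)
  then have "norm (x - blinfun_apply p x *\<^sub>R y) = 1 / d"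
    using x(2) by (simp add: field_simps)
  then show ?thesis
    using xi_ge[OF x(1) y p(1)] by simp
qed

lemma convex_contains_on_line:
  fixes u y :: "'a::real_vector"
  assumes S: "convex S" and st: "u + s *\<^sub>R y \<in> S" "u + t *\<^sub>R y \<in> S" "s \<le> c" "c \<le> t"
  shows "u + c *\<^sub>R y \<in> S"
proof -
  have "c \<in> closed_segment s t"
    using st(3,4) by (simp add: closed_segment_eq_real_ivl)
  then obtain \<theta> where \<theta>: "0 \<le> \<theta>" "\<theta> \<le> 1" "c = (1 - \<theta>) * s + \<theta> * t"
    by (auto simp: in_segment)
  have "(1 - \<theta>) *\<^sub>R (u + s *\<^sub>R y) + \<theta> *\<^sub>R (u + t *\<^sub>R y) \<in> S"
    using S st(1,2) \<theta>(1,2) by (intro convexD) auto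
  then show ?thesis
    by (simp add: \<theta>(3) algebra_simps)
qed

text \<open>At the parameter \<open>\<mu> / 2\<close> convexity suffices: the points of \<open>d *\<^sub>R x + \<real> y\<close> at the parameters \<open>- b\<close>,
\<open>0\<close> and \<open>\<mu> - b\<close> are in the ball, and \<open>- b \<le> - \<mu> / 2\<close> or \<open>\<mu> / 2 \<le> \<mu> - b\<close>. The term
\<open>2 * r - \<mu>\<close> is the price of replacing \<open>\<mu> / 2\<close> by \<open>r\<close>.\<close>

lemma chord_length_bounds_xi:
  fixes y e :: "'a::real_normed_vector"
  assumes y: "norm y = 1" and e: "norm e = 1" and orth: "quasiorthogonal e y"
    and \<mu>: "0 \<le> \<mu>" "norm (e + \<mu> *\<^sub>R y) \<le> 1" and r: "\<mu> / 2 \<le> r" "r \<le> 1 / 2"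
  shows "1 / xi TYPE('a) + supp_convexity_modulus TYPE('a) r \<le> 1 + (2 * r - \<mu>)"
proof -
  obtain x b d where d: "0 < d" "d \<le> 1" and x: "norm x = 1" and dx: "d *\<^sub>R x = e + b *\<^sub>R y"
    and xy: "quasiorthogonal y x"
    using nearest_point_on_line[OF y e orth] by metis
  define h where "h t = d *\<^sub>R x + t *\<^sub>R y" for t
  have conv: "h c \<in> cball 0 1" if "h s \<in> cball 0 1" "h t \<in> cball 0 1" "s \<le> c" "c \<le> t" for s t c
    using convex_contains_on_line[OF convex_cball] that unfolding h_def by blast
  have h0: "h 0 \<in> cball 0 1"
    using d x by (simp add: h_def)
  have hl: "h (- b) \<in> cball 0 1"
    using e by (simp add: h_def dx)
  have "h (\<mu> - b) = e + \<mu> *\<^sub>R y"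
    by (simp add: h_def dx algebra_simps)
  then have hr: "h (\<mu> - b) \<in> cball 0 1"
    using \<mu>(2) by simp
  have "norm (h (\<mu> / 2)) \<le> 1 \<or> norm (h (- (\<mu> / 2))) \<le> 1"
  proof (cases "\<mu> / 2 \<le> b")
    case True
    then have "h (- (\<mu> / 2)) \<in> cball 0 1"
      using \<mu>(1) by (intro conv[OF hl h0]) auto
    then show ?thesis by simp
  next
    case False
    then have "h (\<mu> / 2) \<in> cball 0 1"
      using \<mu>(1) by (intro conv[OF h0 hr]) auto
    then show ?thesis by simp
  qed
  then have "\<exists>y'\<in>{y, - y}. norm (d *\<^sub>R x + (\<mu> / 2) *\<^sub>R y') \<le> 1"
    by (simp add: h_def)
  then obtain y' where y': "y' = y \<or> y' = - y" "norm (d *\<^sub>R x + (\<mu> / 2) *\<^sub>R y') \<le> 1"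
    by blast
  then have y'1: "norm y' = 1" and xy': "quasiorthogonal y' x"
    using y xy quasiorthogonal_uminus_left by auto
  have "norm (x + (\<mu> / 2) *\<^sub>R y' - (1 - d) *\<^sub>R x) \<le> 1"
    using y'(2) by (simp add: algebra_simps)
  then have "supp_lambda x y' r \<le> (1 - d) + 2 * (r - \<mu> / 2)"
    using \<mu>(1) r d by (intro supp_lambda_slope_le[OF x y'1 xy']) auto
  moreover have "supp_convexity_modulus TYPE('a) r \<le> supp_lambda x y' r"
    using \<mu>(1) r by (intro supp_convexity_modulus_le[OF x y'1 xy']) auto
  moreover have "1 / xi TYPE('a) \<le> d"
  proof -
    have "1 / d \<le> xi TYPE('a)"
      using xi_ge_inverse_distance[OF y e orth x d(1) dx] .
    moreover from this have "0 < xi TYPE('a)"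
      using d(1) by (smt (verit) divide_pos_pos)
    ultimately show ?thesis
      using d(1) by (simp add: field_simps)
  qed
  ultimately show ?thesis
    by simp
qed

text \<open>For \<open>c \<ge> 0\<close>, going from \<open>y + e\<close> down by \<open>1 - c\<close> in the direction \<open>- y\<close> leads to the point
\<open>e + c *\<^sub>R y\<close> of the ball, so \<open>\<lambda>(y, e, 1) \<le> 1 - c\<close>. Negative \<open>c\<close> is the same for \<open>- e\<close>.\<close>

lemma chord_length_le:
  fixes y e :: "'a::real_normed_vector"
  assumes y: "norm y = 1" and e: "norm e = 1" and orth: "quasiorthogonal e y"
    and c: "norm (e + c *\<^sub>R y) \<le> 1"
  shows "\<bar>c\<bar> \<le> 1 - supp_convexity_modulus TYPE('a) 1"
proof -
  have *: "c' \<le> 1 - supp_convexity_modulus TYPE('a) 1"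
    if e': "norm e' = 1" "quasiorthogonal e' y" "norm (e' + c' *\<^sub>R y) \<le> 1" for c' e'
  proof -
    have "norm (y + 1 *\<^sub>R e' - (1 - c') *\<^sub>R y) \<le> 1"
      using e'(3) by (simp add: algebra_simps)
    then have "supp_lambda y e' 1 \<le> 1 - c'"
      by (intro supp_lambda_le[OF y e'(1,2)]) auto
    moreover have "supp_convexity_modulus TYPE('a) 1 \<le> supp_lambda y e' 1"
      by (intro supp_convexity_modulus_le[OF y e'(1,2)]) auto
    ultimately show ?thesis by simp
  qed
  have "norm (- e + (- c) *\<^sub>R y) = norm (e + c *\<^sub>R y)"
    by (metis minus_add_distrib norm_minus_cancel scaleR_minus_left)
  then have "- c \<le> 1 - supp_convexity_modulus TYPE('a) 1"
    using e c quasiorthogonal_uminus_left[OF orth] by (intro *[of "- e"]) auto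
  then show ?thesis
    using *[OF e orth c] by simp
qed

text \<open>The projection of \<open>x\<close> has the direction of a unit vector \<open>e\<close>, and its norm is at most the
reciprocal of the distance \<open>d\<close> of \<open>e\<close> from \<open>\<real> y\<close>. It remains to find a pair with
\<open>\<lambda>(\<cdot>, \<cdot>, r) \<ge> 1 - d\<close>.\<close>

lemma norm_projection_le_supp_smoothness:
  fixes x y :: "'a::real_normed_vector"
  assumes dim: "\<exists>B :: 'a set. independent B \<and> card B = 2"
    and x: "norm x = 1" and y: "norm y = 1" and p: "p \<in> J1 y"
    and r: "r = (1 - supp_convexity_modulus TYPE('a) 1) / 2"
  shows "norm (x - blinfun_apply p x *\<^sub>R y) \<le> 1 / (1 - supp_smoothness_modulus TYPE('a) r)"
proof -
  have r_bounds: "0 \<le> r" "r \<le> 1 / 2"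
    using supp_convexity_modulus_bounds[OF dim, of 1] r by auto
  have \<Lambda>: "supp_smoothness_modulus TYPE('a) r \<le> 1 / 2"
    using supp_smoothness_modulus_le_self[OF dim, of r] r_bounds by simp
  define z where "z = x - blinfun_apply p x *\<^sub>R y"
  define R where "R = norm z"
  show ?thesis
  proof (cases "z = 0")
    case True
    then show ?thesis
      using \<Lambda> by (simp add: z_def[symmetric])
  next
    case False
    then have R: "0 < R"
      by (simp add: R_def)
    define e where "e = z /\<^sub>R R"
    have e: "norm e = 1"
      using R by (simp add: e_def R_def)
    have "blinfun_apply p e = 0"
      using p y by (simp add: e_def z_def J1_def blinfun.diff_right blinfun.scaleR_right)
    then have orth: "quasiorthogonal e y"
      using p y by (auto simp: quasiorthogonal_def)
    obtain x' b d where d: "0 < d" "d \<le> 1" and x': "norm x' = 1"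
      and dx: "d *\<^sub>R x' = e + b *\<^sub>R y" and xy: "quasiorthogonal y x'"
      and dist: "\<And>s. d \<le> norm (e + s *\<^sub>R y)"
      using nearest_point_on_line[OF y e orth] by metis
    have "e + (blinfun_apply p x / R) *\<^sub>R y = x /\<^sub>R R"
      by (simp add: e_def z_def algebra_simps divide_inverse)
    then have "d \<le> 1 / R"
      using dist[of "blinfun_apply p x / R"] x R by (simp add: divide_inverse)
    then have R_le: "R \<le> 1 / d"
      using R d by (simp add: field_simps)
    define h where "h t = d *\<^sub>R x' + t *\<^sub>R y" for t
    have h_eq: "h t = e + (b + t) *\<^sub>R y" for t
      by (simp add: h_def dx algebra_simps)
    \<comment> \<open>If both points were in the open ball, the chords from \<open>e = h (- b)\<close> through them would
      have length at most \<open>2 * r\<close>; this forces \<open>e\<close> between them, hence into the open ball.\<close>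
    have "1 \<le> norm (h r) \<or> 1 \<le> norm (h (- r))"
    proof (rule ccontr)
      assume "\<not> (1 \<le> norm (h r) \<or> 1 \<le> norm (h (- r)))"
      then have in_ball: "h r \<in> ball 0 1" "h (- r) \<in> ball 0 1"
        by auto
      then have "\<bar>b + c\<bar> \<le> 2 * r" if "c = r \<or> c = - r" for c
      proof -
        have "norm (e + (b + c) *\<^sub>R y) \<le> 1"
          using that in_ball by (auto simp: h_eq)
        from chord_length_le[OF y e orth this] show ?thesis
          by (simp add: r)
      qed
      from this[of r] this[of "- r"] have "- r \<le> - b" "- b \<le> r"
        by auto
      then have "h (- b) \<in> ball 0 1"
        using convex_contains_on_line[OF convex_ball] in_ball unfolding h_def by blast
      then show False
        using e by (simp add: h_eq)
    qed
    then have "\<exists>y'\<in>{y, - y}. 1 \<le> norm (d *\<^sub>R x' + r *\<^sub>R y')"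
      by (simp add: h_def)
    then obtain y' where y': "y' = y \<or> y' = - y" "1 \<le> norm (d *\<^sub>R x' + r *\<^sub>R y')"
      by blast
    then have y'1: "norm y' = 1" and xy': "quasiorthogonal y' x'"
      using y xy quasiorthogonal_uminus_left by auto
    have "1 \<le> norm (x' + r *\<^sub>R y' - (1 - d) *\<^sub>R x')"
      using y'(2) by (simp add: algebra_simps)
    then have "1 - d \<le> supp_lambda x' y' r"
      using r_bounds d by (intro supp_lambda_ge[OF x' y'1 xy']) auto
    also have "\<dots> \<le> supp_smoothness_modulus TYPE('a) r"
      using r_bounds by (intro supp_smoothness_modulus_ge[OF x' y'1 xy']) auto
    finally have "1 / d \<le> 1 / (1 - supp_smoothness_modulus TYPE('a) r)"
      using \<Lambda> d by (intro divide_left_mono mult_pos_pos) auto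
    then show ?thesis
      using R_le by (simp add: R_def z_def)
  qed
qed

theorem theorem4:
  assumes dim_ge_2: "\<exists>B :: 'a::banach set. independent B \<and> card B = 2"
  shows
    "1 / (1 - supp_convexity_modulus TYPE('a) ((1 - supp_convexity_modulus TYPE('a) 1) / 2))
       \<le> xi TYPE('a) \<and>
     xi TYPE('a)
       \<le> 1 / (1 - supp_smoothness_modulus TYPE('a) ((1 - supp_convexity_modulus TYPE('a) 1) / 2))"
proof
  define r where "r = (1 - supp_convexity_modulus TYPE('a) 1) / 2"
  have r: "0 \<le> r" "r \<le> 1 / 2"
    using supp_convexity_modulus_bounds[OF dim_ge_2, of 1] by (auto simp: r_def)
  obtain u v :: 'a where uv: "norm u = 1" "norm v = 1" "quasiorthogonal v u"
    using exists_quasiorthogonal_unit_pair[OF dim_ge_2] .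
  have "1 / xi TYPE('a) + supp_convexity_modulus TYPE('a) r - 2 * r
      \<le> supp_convexity_modulus TYPE('a) 1"
  proof (rule supp_convexity_modulus_ge[OF dim_ge_2])
    fix y e :: 'a
    assume ye: "norm y = 1" "norm e = 1" "quasiorthogonal e y"
    define \<mu> where "\<mu> = 1 - supp_lambda y e 1"
    have "norm (e + \<mu> *\<^sub>R y) \<le> 1" "0 \<le> \<mu>"
      using supp_lambda_norm[OF ye, of 1] supp_lambda_le_self[OF ye, of 1]
      by (simp_all add: \<mu>_def algebra_simps)
    moreover have "\<mu> / 2 \<le> r"
      using supp_convexity_modulus_le[OF ye, of 1] by (simp add: \<mu>_def r_def)
    ultimately have "1 / xi TYPE('a) + supp_convexity_modulus TYPE('a) r \<le> 1 + (2 * r - \<mu>)"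
      using r by (intro chord_length_bounds_xi[OF ye]) auto
    then show "1 / xi TYPE('a) + supp_convexity_modulus TYPE('a) r - 2 * r
        \<le> supp_lambda y e 1"
      by (simp add: \<mu>_def)
  qed
  then have lower: "1 / xi TYPE('a) \<le> 1 - supp_convexity_modulus TYPE('a) r"
    by (simp add: r_def field_simps)
  have "1 \<le> xi TYPE('a)"
  proof -
    obtain p where "p \<in> J1 u" "blinfun_apply p v = 0"
      using uv(3) by (auto simp: quasiorthogonal_def)
    then show ?thesis
      using xi_ge[OF uv(2,1), of p] uv(2) by simp
  qed
  then have "1 / (1 - supp_convexity_modulus TYPE('a) r) \<le> 1 / (1 / xi TYPE('a))"
    using lower supp_convexity_modulus_bounds(2)[OF dim_ge_2, of r] r
    by (intro divide_left_mono mult_pos_pos) auto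
  then show "1 / (1 - supp_convexity_modulus TYPE('a) ((1 - supp_convexity_modulus TYPE('a) 1) / 2))
       \<le> xi TYPE('a)"
    by (simp add: r_def)
  show "xi TYPE('a)
       \<le> 1 / (1 - supp_smoothness_modulus TYPE('a) ((1 - supp_convexity_modulus TYPE('a) 1) / 2))"
    using uv(1) norm_projection_le_supp_smoothness[OF dim_ge_2 _ _ _ refl]
    by (intro xi_le) blast+
qed

end
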